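(* Let $\kappa>0$. There exist $\alpha_0$ (depending on $\kappa$) and $\rho_0$ (depending on $\kappa$ and $\alpha$) such that if $\alpha>\alpha_0$ and $\rho>\rho_0$, then for a constructed traveling wave $(c,F,Q,s^* )$ (in the sense defined in the context) the speed $c$, the search function $s^*$ and the profile $F$ are related by $$c=2\sqrt{\kappa\alpha\gamma},\qquad \gamma=\int_{-\infty}^\infty s^*(y)(-F_y(y))\,dy,$$ and $\gamma<1$.
   Context: Let $\kappa,\alpha,\rho>0$ and let $$H(r)=\begin{cases}2r,& r>1,\\ 1+r^2,&0<r<1,\\ 1,& r<0\end{cases}$$ (extended by continuity). Traveling wave system: a speed $c$ and functions $F,Q$ on $\mathbb{R}$ with $$-cF_x-\kappa F_{xx}=\alpha F(x)\int_{-\infty}^xs^*(y)(-F_y(y))\,dy,\qquad \rho Q=cQ-cQ_x+\kappa Q_{xx}+e^xH(R(x)),$$ $$R(x)=\frac{\alpha}{2}e^{-x}\int_x^\infty[Q(y)-Q(x)](-F_y(y))\,dy,\qquad s^*(x)=\min(1,R(x)),$$ $F(-\infty)=1$, $F(+\infty)=0$, $\lim_{x\to-\infty}Q(x)$ exists and is positive, $\lim_{x\to+\infty}Q(x)e^{-x}=1/(\rho-\kappa)$. (Here $s^*$ is the square root of the fraction of time spent searching, the search function being $\alpha\sqrt{\cdot}$.) Finite interval problem on $[-a,a]$: a speed $c^a$ and functions $F^a,Q^a$ with $$-c^aF^a_x-\kappa F^a_{xx}=\alpha F^a(x)\int_{-a}^xs_a^*(y)(-F^a_y(y))\,dy,\qquad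 \rho Q^a=c^aQ^a-c^aQ^a_x+\kappa Q^a_{xx}+e^xH(R^a(x)),$$ $$R^a(x)=\frac{\alpha}{2}e^{-x}\int_x^a[Q^a(y)-Q^a(x)](-F^a_y(y))\,dy,\qquad s_a^*(x)=\min(1,R^a(x)),$$ $F^a(-a)=1$, $F^a(a)=0$, $F^a(0)=1/2$, $Q^a_x(-a)=0$, $Q^a_x(a)=Q^a(a)$, with $F^a$ and $R^a$ monotonically decreasing and $Q^a$ increasing, and such that, with constants independent of $a$, $|c^a|+\int_{-a}^a|F^a_x|^2dx\le C$, $A_1e^x\le Q^a(x)\le A_2e^x+B$ (with $A_1,A_2,B>0$), and $x_0^-<x_0^a<x_0^+$ where $x_0^a=\sup\{x: s_a^*(x)=1\}$. A constructed traveling wave is a quadruple $(c,F,Q,s^* )$ solving the traveling wave system, with $0<c\le 2\sqrt{\kappa\alpha}$, $F$ monotonically decreasing and $Q$ monotonically increasing, that is obtained as a limit, along some sequence $a_n\to+\infty$, of such solutions of the finite interval problem: $c^{a_n}\to c$ and $F^{a_n}\to F$, $Q^{a_n}\to Q$ in $C^2_{loc}(\mathbb{R})$, with $s_{a_n}^*\to s^*$. *)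

theory Defs
  imports "HOL-Analysis.Analysis"
begin

text \<open>
  The system is posed on the line and on \<open>[-a, a]\<close>. A common domain parameter \<open>S\<close> (either
  \<open>UNIV\<close> or \<open>{-a..a}\<close>) serves both: derivatives are taken within \<open>S\<close>, hence one-sided at
  the endpoints of \<open>{-a..a}\<close>, and functions carry no information outside \<open>S\<close>.
\<close>

definition Dx :: "real set \<Rightarrow> (real \<Rightarrow> real) \<Rightarrow> real \<Rightarrow> real" where
  "Dx S f x = vector_derivative f (at x within S)"

definition C2_on :: "real set \<Rightarrow> (real \<Rightarrow> real) \<Rightarrow> bool" where
  "C2_on S f \<longleftrightarrow>
     f differentiable_on S \<and> Dx S f differentiable_on S \<and> continuous_on S (Dx S (Dx S f))"

text \<open>The values at \<open>r = 0\<close> and \<open>r = 1\<close> are the continuous extensions.\<close>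

definition H :: "real \<Rightarrow> real" where
  "H r = (if r > 1 then 2 * r else if r > 0 then 1 + r\<^sup>2 else 1)"

text \<open>\<open>S \<inter> {x..}\<close> is \<open>[x, \<infinity>)\<close> on the line and \<open>[x, a]\<close> on \<open>[-a, a]\<close>;
  \<open>S \<inter> {..x}\<close> is \<open>(-\<infinity>, x]\<close> and \<open>[-a, x]\<close>, respectively.\<close>

definition R_fun :: "real \<Rightarrow> real set \<Rightarrow> (real \<Rightarrow> real) \<Rightarrow> (real \<Rightarrow> real) \<Rightarrow> real \<Rightarrow> real" where
  "R_fun \<alpha> S F Q x =
     \<alpha> / 2 * exp (- x) * (LBINT y:S \<inter> {x..}. (Q y - Q x) * (- Dx S F y))"

text \<open>The integrability conditions say that the integrals in the system converge; they are
  automatic for \<open>S = {-a..a}\<close>, but on the line the Bochner integral of a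
  non-integrable function would silently be \<open>0\<close>.\<close>

definition solves_system ::
  "real \<Rightarrow> real \<Rightarrow> real \<Rightarrow> real set \<Rightarrow> real \<Rightarrow> (real \<Rightarrow> real) \<Rightarrow> (real \<Rightarrow> real) \<Rightarrow> (real \<Rightarrow> real) \<Rightarrow> bool"
where
  "solves_system \<kappa> \<alpha> \<rho> S c F Q s \<longleftrightarrow>
     C2_on S F \<and> C2_on S Q \<and>
     (\<forall>x\<in>S. set_integrable lborel (S \<inter> {x..}) (\<lambda>y. (Q y - Q x) * (- Dx S F y))) \<and>
     (\<forall>x\<in>S. set_integrable lborel (S \<inter> {..x}) (\<lambda>y. s y * (- Dx S F y))) \<and>
     (\<forall>x\<in>S. s x = min 1 (R_fun \<alpha> S F Q x)) \<and>
     (\<forall>x\<in>S. - c * Dx S F x - \<kappa> * Dx S (Dx S F) x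
              = \<alpha> * F x * (LBINT y:S \<inter> {..x}. s y * (- Dx S F y))) \<and>
     (\<forall>x\<in>S. \<rho> * Q x
              = c * Q x - c * Dx S Q x + \<kappa> * Dx S (Dx S Q) x + exp x * H (R_fun \<alpha> S F Q x))"

definition traveling_wave ::
  "real \<Rightarrow> real \<Rightarrow> real \<Rightarrow> real \<Rightarrow> (real \<Rightarrow> real) \<Rightarrow> (real \<Rightarrow> real) \<Rightarrow> (real \<Rightarrow> real) \<Rightarrow> bool"
where
  "traveling_wave \<kappa> \<alpha> \<rho> c F Q s \<longleftrightarrow>
     solves_system \<kappa> \<alpha> \<rho> UNIV c F Q s \<and>
     (F \<longlongrightarrow> 1) at_bot \<and> (F \<longlongrightarrow> 0) at_top \<and>
     (\<exists>L>0. (Q \<longlongrightarrow> L) at_bot) \<and>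
     ((\<lambda>x. Q x * exp (- x)) \<longlongrightarrow> 1 / (\<rho> - \<kappa>)) at_top"

definition finite_interval_solution ::
  "real \<Rightarrow> real \<Rightarrow> real \<Rightarrow> real \<Rightarrow> real \<Rightarrow> (real \<Rightarrow> real) \<Rightarrow> (real \<Rightarrow> real) \<Rightarrow> (real \<Rightarrow> real) \<Rightarrow> bool"
where
  "finite_interval_solution \<kappa> \<alpha> \<rho> a c F Q s \<longleftrightarrow>
     solves_system \<kappa> \<alpha> \<rho> {-a..a} c F Q s \<and>
     F (- a) = 1 \<and> F a = 0 \<and> F 0 = 1 / 2 \<and>
     Dx {-a..a} Q (- a) = 0 \<and> Dx {-a..a} Q a = Q a \<and>
     antimono_on {-a..a} F \<and> antimono_on {-a..a} (R_fun \<alpha> {-a..a} F Q) \<and>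
     mono_on {-a..a} Q"

text \<open>The bounds whose constants must not depend on \<open>a\<close>. Non-emptiness of the set under
  \<open>Sup\<close> is part of \<open>x0m < sup \<dots>\<close>, since the supremum of the empty set is \<open>-\<infinity>\<close>.\<close>

definition finite_interval_bounds ::
  "real \<Rightarrow> real \<Rightarrow> real \<Rightarrow> real \<Rightarrow> real \<Rightarrow> real \<Rightarrow>
   real \<Rightarrow> real \<Rightarrow> (real \<Rightarrow> real) \<Rightarrow> (real \<Rightarrow> real) \<Rightarrow> (real \<Rightarrow> real) \<Rightarrow> bool"
where
  "finite_interval_bounds C A1 A2 B x0m x0p a c F Q s \<longleftrightarrow>
     \<bar>c\<bar> + (LBINT x:{-a..a}. \<bar>Dx {-a..a} F x\<bar>\<^sup>2) \<le> C \<and>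
     (\<forall>x\<in>{-a..a}. A1 * exp x \<le> Q x \<and> Q x \<le> A2 * exp x + B) \<and>
     {x\<in>{-a..a}. s x = 1} \<noteq> {} \<and>
     x0m < Sup {x\<in>{-a..a}. s x = 1} \<and> Sup {x\<in>{-a..a}. s x = 1} < x0p"

text \<open>Every compact \<open>K\<close> lies in \<open>{-a n..a n}\<close> for all large \<open>n\<close>, so values of \<open>f n\<close> outside its
  domain do not matter.\<close>

definition C2_loc_limit ::
  "(nat \<Rightarrow> real) \<Rightarrow> (nat \<Rightarrow> real \<Rightarrow> real) \<Rightarrow> (real \<Rightarrow> real) \<Rightarrow> bool"
where
  "C2_loc_limit a f g \<longleftrightarrow>
     (\<forall>K. compact K \<longrightarrow>
        uniform_limit K f g sequentially \<and>
        uniform_limit K (\<lambda>n. Dx {-a n..a n} (f n)) (Dx UNIV g) sequentially \<and>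
        uniform_limit K (\<lambda>n. Dx {-a n..a n} (Dx {-a n..a n} (f n)))
          (Dx UNIV (Dx UNIV g)) sequentially)"

text \<open>Pointwise convergence of the search functions suffices: they are monotone on \<open>[-a, a]\<close>
  and the limit \<open>s\<close> is continuous, so the convergence is then locally uniform.\<close>

definition constructed_traveling_wave ::
  "real \<Rightarrow> real \<Rightarrow> real \<Rightarrow> real \<Rightarrow> (real \<Rightarrow> real) \<Rightarrow> (real \<Rightarrow> real) \<Rightarrow> (real \<Rightarrow> real) \<Rightarrow> bool"
where
  "constructed_traveling_wave \<kappa> \<alpha> \<rho> c F Q s \<longleftrightarrow>
     traveling_wave \<kappa> \<alpha> \<rho> c F Q s \<and>
     0 < c \<and> c \<le> 2 * sqrt (\<kappa> * \<alpha>) \<and> antimono F \<and> mono Q \<and>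
     (\<exists>(a :: nat \<Rightarrow> real) ca Fa Qa sa C A1 A2 B x0m x0p.
        A1 > 0 \<and> A2 > 0 \<and> B > 0 \<and>
        (\<forall>n. a n > 0) \<and> filterlim a at_top sequentially \<and>
        (\<forall>n. finite_interval_solution \<kappa> \<alpha> \<rho> (a n) (ca n) (Fa n) (Qa n) (sa n)) \<and>
        (\<forall>n. finite_interval_bounds C A1 A2 B x0m x0p (a n) (ca n) (Fa n) (Qa n) (sa n)) \<and>
        ca \<longlonglongrightarrow> c \<and> C2_loc_limit a Fa F \<and> C2_loc_limit a Qa Q \<and>
        (\<forall>x. (\<lambda>n. sa n x) \<longlonglongrightarrow> s x))"

end

theory Submission imports Defs begin

text \<open>
  Write \<open>\<gamma>\<close> for the total search mass \<open>\<integral> s (-F')\<close>. The profile equation is linear in \<open>F\<close>,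
  \<open>\<kappa> F'' + c F' + J F = 0\<close>, with the nonlocal coefficient
  \<open>J(x) = \<alpha> \<integral>\<^bsub>-\<infinity>\<^esub>\<^bsup>x\<^esup> s (-F')\<close>, which increases from \<open>0\<close> to \<open>\<alpha> \<gamma>\<close>. The speed is determined by
  the constant-coefficient equation at \<open>+\<infinity>\<close>, whose characteristic polynomial has discriminant
  \<open>c\<^sup>2 - 4 \<kappa> \<alpha> \<gamma>\<close>, as for a pulled Fisher-KPP front.

  \<^item> \<open>c\<^sup>2 \<ge> 4 \<kappa> \<alpha> \<gamma>\<close> (\<open>wave_speed_ge\<close>): complex characteristic roots would force \<open>F\<close> to oscillate,
    whereas \<open>F > 0\<close>. Quantitatively, the Riccati variable \<open>-F'/F\<close> would blow up at a finite point.

  \<^item> \<open>c\<^sup>2 \<le> 4 \<kappa> \<alpha> \<gamma>\<close> (\<open>constructed_wave_speed_le\<close>): this bound comes from the construction, namely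
    from the Dirichlet condition at \<open>a\<close>, which selects the minimal speed.
    On \<open>[-a, a]\<close> put \<open>w(x) = exp (c x / (2 \<kappa>)) F(x)\<close>. Then
    \<open>4 \<kappa>\<^sup>2 w'' = (c\<^sup>2 - 4 \<kappa> J) w\<close>, so that \<open>w\<close> would be convex if \<open>c\<^sup>2 \<ge> 4 \<kappa> \<alpha> \<gamma>\<^sub>a\<close>. But \<open>w(-a)\<close> is
    exponentially small, \<open>w(0) = 1/2\<close> and \<open>w(a) = 0\<close>, which no convex function satisfies
    (\<open>finite_speed_bound\<close>). In the limit \<open>a \<rightarrow> \<infinity>\<close> no search mass escapes to infinity, because
    \<open>s \<le> 1\<close> bounds the mass outside \<open>[-X, X]\<close> by \<open>(1 - F(-X)) + F(X)\<close>
    (\<open>finite_mass_tail_bound\<close>), and on \<open>[-X, X]\<close> dominated convergence applies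
    (\<open>mass_on_compact_converges\<close>).

  \<^item> \<open>\<gamma> < 1\<close> (\<open>wave_mass_less_one\<close>): the factor \<open>exp (-x)\<close> in \<open>R\<close> makes \<open>s \<le> 1/2\<close> far to the right,
    where \<open>F\<close> still has positive mass to lose, while the total mass of \<open>-F'\<close> is \<open>1\<close>.
\<close>

section \<open>Linear second-order profile equations\<close>

text \<open>
  The substitution \<open>w(x) = exp (c x / (2 \<kappa>)) f(x)\<close> removes the first-order term and leaves
  \<open>4 \<kappa>\<^sup>2 w'' = (c\<^sup>2 - 4 \<kappa> J) w\<close>. For a speed violating the bound the right-hand side is nonnegative
  and \<open>w'\<close> is nondecreasing, yet \<open>w\<close> first rises from \<open>-a\<close> to \<open>0\<close> and then falls to \<open>0\<close> at \<open>a\<close>.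
\<close>

lemma dirichlet_front_speed_bound:
  fixes f f1 f2 J :: "real \<Rightarrow> real"
  assumes "\<kappa> > 0" "a > 0" "continuous_on {-a..a} f"
    and f1: "\<And>x. -a < x \<Longrightarrow> x < a \<Longrightarrow> (f has_real_derivative f1 x) (at x)"
    and f2: "\<And>x. -a < x \<Longrightarrow> x < a \<Longrightarrow> (f1 has_real_derivative f2 x) (at x)"
    and ode: "\<And>x. -a < x \<Longrightarrow> x < a \<Longrightarrow> - c * f1 x - \<kappa> * f2 x = f x * J x"
    and nonneg: "\<And>x. -a < x \<Longrightarrow> x < a \<Longrightarrow> 0 \<le> f x"
    and J: "\<And>x. -a < x \<Longrightarrow> x < a \<Longrightarrow> J x \<le> M"
    and left: "exp (- (c * a / (2 * \<kappa>))) * f (-a) < f 0"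
    and right: "f a = 0" "f 0 > 0"
  shows "c\<^sup>2 < 4 * \<kappa> * M"
proof (rule ccontr)
  assume "\<not> c\<^sup>2 < 4 * \<kappa> * M"
  then have M: "4 * \<kappa> * M \<le> c\<^sup>2" by simp
  define k where "k = c / (2 * \<kappa>)"
  define w where "w x = exp (k * x) * f x" for x
  define w1 where "w1 x = exp (k * x) * (f1 x + k * f x)" for x
  define w2 where "w2 x = exp (k * x) * (f2 x + 2 * k * f1 x + k\<^sup>2 * f x)" for x
  have w1: "(w has_real_derivative w1 x) (at x)" if "-a < x" "x < a" for x
    unfolding w_def w1_def
    by (rule derivative_eq_intros f1[OF that] refl | simp add: algebra_simps)+
  have w2: "(w1 has_real_derivative w2 x) (at x)" if "-a < x" "x < a" for x
    unfolding w1_def w2_def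
    by (rule derivative_eq_intros f1[OF that] f2[OF that] refl
        | simp add: algebra_simps power2_eq_square)+
  have cont: "continuous_on {-a..a} w"
    unfolding w_def by (intro continuous_intros assms)
  have w2_nonneg: "w2 x \<ge> 0" if "-a < x" "x < a" for x
  proof -
    have eq: "\<kappa> * f2 x = - c * f1 x - f x * J x" using ode[OF that] by simp
    have "4 * \<kappa> * (\<kappa> * (f2 x + 2 * k * f1 x + k\<^sup>2 * f x))
        = 4 * \<kappa> * (\<kappa> * f2 x) + 4 * \<kappa> * c * f1 x + c\<^sup>2 * f x"
      using \<open>\<kappa> > 0\<close> by (simp add: k_def field_simps power2_eq_square)
    also have "\<dots> = (c\<^sup>2 - 4 * \<kappa> * J x) * f x"
      unfolding eq by (simp add: algebra_simps)
    finally have "4 * \<kappa> * (\<kappa> * (f2 x + 2 * k * f1 x + k\<^sup>2 * f x)) = (c\<^sup>2 - 4 * \<kappa> * J x) * f x" .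
    moreover have "4 * \<kappa> * J x \<le> 4 * \<kappa> * M"
      using J[OF that] \<open>\<kappa> > 0\<close> by simp
    ultimately have "0 \<le> 4 * \<kappa> * (\<kappa> * (f2 x + 2 * k * f1 x + k\<^sup>2 * f x))"
      using M nonneg[OF that] by simp
    then have "0 \<le> f2 x + 2 * k * f1 x + k\<^sup>2 * f x"
      using \<open>\<kappa> > 0\<close> by (simp add: zero_le_mult_iff)
    then show ?thesis by (simp add: w2_def)
  qed
  obtain \<xi> where \<xi>: "-a < \<xi>" "\<xi> < 0" "w 0 - w (-a) = w1 \<xi> * (0 - (-a))"
  proof (rule mvt[of "-a" 0 w "\<lambda>x h. w1 x * h"])
    show "-a < 0" using \<open>a > 0\<close> by simp
    show "continuous_on {-a..0} w" by (rule continuous_on_subset[OF cont]) (use \<open>a > 0\<close> in auto)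
    show "(w has_derivative (\<lambda>h. w1 x * h)) (at x)" if "-a < x" "x < 0" for x
      using w1[of x] that \<open>a > 0\<close> by (simp add: has_field_derivative_def)
  qed
  obtain \<eta> where \<eta>: "0 < \<eta>" "\<eta> < a" "w a - w 0 = w1 \<eta> * (a - 0)"
  proof (rule mvt[of 0 a w "\<lambda>x h. w1 x * h"])
    show "0 < a" by fact
    show "continuous_on {0..a} w" by (rule continuous_on_subset[OF cont]) (use \<open>a > 0\<close> in auto)
    show "(w has_derivative (\<lambda>h. w1 x * h)) (at x)" if "0 < x" "x < a" for x
      using w1[of x] that \<open>a > 0\<close> by (simp add: has_field_derivative_def)
  qed
  have "w (-a) < w 0" using left by (simp add: w_def k_def)
  then have "w1 \<xi> * a > 0" using \<xi> by simp
  then have pos: "w1 \<xi> > 0" using \<open>a > 0\<close> by (simp add: zero_less_mult_iff)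
  have "w a < w 0" using right by (simp add: w_def)
  then have "w1 \<eta> * a < 0" using \<eta> by simp
  then have neg: "w1 \<eta> < 0" using \<open>a > 0\<close> by (simp add: mult_less_0_iff)
  have "w1 \<xi> \<le> w1 \<eta>"
  proof (rule DERIV_nonneg_imp_nondecreasing[of \<xi> \<eta> w1])
    show "\<xi> \<le> \<eta>" using \<xi> \<eta> by simp
    show "\<exists>y. (w1 has_real_derivative y) (at x) \<and> 0 \<le> y" if "\<xi> \<le> x" "x \<le> \<eta>" for x
      using w2[of x] w2_nonneg[of x] that \<xi> \<eta> by auto
  qed
  then show False using pos neg by simp
qed

text \<open>
  The equation reads \<open>\<kappa> (exp (c x / \<kappa>) f')' = - exp (c x / \<kappa>) J f\<close>, and the right-hand side is
  nonpositive. A zero of the nonnegative \<open>f\<close> is a minimum, so \<open>f'\<close> vanishes there and hence is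
  nonnegative to its left. Then \<open>f \<le> 0\<close> to the left, against the limit \<open>1\<close>.
\<close>

lemma front_positive:
  fixes f f1 f2 J :: "real \<Rightarrow> real"
  assumes "\<kappa> > 0"
    and f1: "\<And>x. (f has_real_derivative f1 x) (at x)"
    and f2: "\<And>x. (f1 has_real_derivative f2 x) (at x)"
    and ode: "\<And>x. - c * f1 x - \<kappa> * f2 x = f x * J x"
    and nonneg: "\<And>x. 0 \<le> f x" "\<And>x. 0 \<le> J x"
    and lim: "(f \<longlongrightarrow> 1) at_bot"
  shows "f X > 0"
proof (rule ccontr)
  assume "\<not> f X > 0"
  then have X: "f X = 0" using nonneg(1)[of X] by simp
  have f1X: "f1 X = 0"
    by (rule DERIV_local_min[OF f1, of 1]) (use X nonneg in auto)
  define z where "z x = exp (c / \<kappa> * x) * f1 x" for x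
  define z1 where "z1 x = exp (c / \<kappa> * x) * (f2 x + c / \<kappa> * f1 x)" for x
  have z1: "(z has_real_derivative z1 x) (at x)" for x
    unfolding z_def z1_def
    by (rule derivative_eq_intros f2 refl | simp add: algebra_simps)+
  have z1_le: "z1 x \<le> 0" for x
  proof -
    have "\<kappa> * (f2 x + c / \<kappa> * f1 x) = - (f x * J x)"
    proof -
      have "\<kappa> * (f2 x + c / \<kappa> * f1 x) = \<kappa> * f2 x + c * f1 x"
        using \<open>\<kappa> > 0\<close> by (simp add: distrib_left)
      then show ?thesis using ode[of x] by simp
    qed
    also have "\<dots> \<le> 0" using nonneg by simp
    finally have "f2 x + c / \<kappa> * f1 x \<le> 0"
      using \<open>\<kappa> > 0\<close> by (simp add: mult_le_0_iff)
    then show ?thesis by (simp add: z1_def mult_le_0_iff)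
  qed
  have f1_nonneg: "f1 x \<ge> 0" if "x \<le> X" for x
  proof -
    have "z X \<le> z x"
      by (rule DERIV_nonpos_imp_nonincreasing[OF that]) (use z1 z1_le in blast)
    then show ?thesis by (simp add: z_def f1X zero_le_mult_iff)
  qed
  have "f x \<le> 0" if "x \<le> X" for x
    using DERIV_nonneg_imp_nondecreasing[OF that, of f] f1 f1_nonneg X by fastforce
  then have "\<forall>\<^sub>F x in at_bot. f x \<le> 0"
    by (auto simp: eventually_at_bot_linorder)
  then have "(1::real) \<le> 0"
    by (rule tendsto_upperbound[OF lim]) simp
  then show False by simp
qed

text \<open>
  With \<open>b = c / (2 \<kappa>)\<close>, the Riccati variable \<open>v = - f' / f\<close> satisfies
  \<open>v' = (v - b)\<^sup>2 + J / \<kappa> - b\<^sup>2\<close>. If the discriminant \<open>c\<^sup>2 - 4 \<kappa> m\<close> were negative, then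
  \<open>v' \<ge> (v - b)\<^sup>2 + d\<^sup>2\<close> with \<open>d > 0\<close>, and the angle \<open>arctan ((v - b) / d)\<close> would grow at rate at least
  \<open>d\<close> on a half-line, although it is confined to an interval of length \<open>\<pi>\<close>.
\<close>

lemma speed_bound_if_positive:
  fixes f f1 f2 J :: "real \<Rightarrow> real"
  assumes "\<kappa> > 0"
    and f1: "\<And>x. X \<le> x \<Longrightarrow> (f has_real_derivative f1 x) (at x)"
    and f2: "\<And>x. X \<le> x \<Longrightarrow> (f1 has_real_derivative f2 x) (at x)"
    and ode: "\<And>x. X \<le> x \<Longrightarrow> - c * f1 x - \<kappa> * f2 x = f x * J x"
    and pos: "\<And>x. X \<le> x \<Longrightarrow> 0 < f x"
    and J: "\<And>x. X \<le> x \<Longrightarrow> m \<le> J x"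
  shows "4 * \<kappa> * m \<le> c\<^sup>2"
proof (rule ccontr)
  assume "\<not> 4 * \<kappa> * m \<le> c\<^sup>2"
  then have disc: "4 * \<kappa> * m - c\<^sup>2 > 0" by simp
  define b where "b = c / (2 * \<kappa>)"
  define d where "d = sqrt (4 * \<kappa> * m - c\<^sup>2) / (2 * \<kappa>)"
  have d: "d > 0" using disc \<open>\<kappa> > 0\<close> by (simp add: d_def)
  have d2: "d\<^sup>2 = m / \<kappa> - b\<^sup>2"
    using disc \<open>\<kappa> > 0\<close> by (simp add: d_def b_def power_divide field_simps power2_eq_square)
  define v where "v x = - f1 x / f x" for x
  define v1 where "v1 x = (v x - b)\<^sup>2 + J x / \<kappa> - b\<^sup>2" for x
  have v1: "(v has_real_derivative v1 x) (at x)" if "X \<le> x" for x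
  proof -
    have f0: "f x \<noteq> 0" using pos[OF that] by simp
    have f2_eq: "f2 x = - (c * f1 x + f x * J x) / \<kappa>"
      using ode[OF that] \<open>\<kappa> > 0\<close> by (simp add: field_simps)
    have "(- f2 x * f x - - f1 x * f1 x) / (f x * f x) = v1 x"
      unfolding f2_eq
      using \<open>\<kappa> > 0\<close> f0 by (simp add: v1_def v_def b_def field_simps power2_eq_square)
    moreover have "(v has_real_derivative (- f2 x * f x - - f1 x * f1 x) / (f x * f x)) (at x)"
      unfolding v_def by (rule DERIV_divide DERIV_minus f1 f2 that f0)+
    ultimately show ?thesis by simp
  qed
  have v1_ge: "v1 x \<ge> d\<^sup>2 + (v x - b)\<^sup>2" if "X \<le> x" for x
    using J[OF that] \<open>\<kappa> > 0\<close> by (simp add: v1_def d2 divide_right_mono)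
  define g where "g x = arctan ((v x - b) / d)" for x
  define g1 where "g1 x = v1 x / d / (1 + ((v x - b) / d)\<^sup>2)" for x
  have g1: "(g has_real_derivative g1 x) (at x)" if "X \<le> x" for x
    unfolding g_def g1_def
    by (rule derivative_eq_intros v1[OF that] refl | use d in \<open>simp add: field_simps\<close>)+
  have g1_ge: "g1 x \<ge> d" if "X \<le> x" for x
  proof -
    have pos': "d\<^sup>2 + (v x - b)\<^sup>2 > 0" using d by (simp add: add_pos_nonneg)
    have "g1 x = d * (v1 x / (d\<^sup>2 + (v x - b)\<^sup>2))"
    proof -
      have "1 + ((v x - b) / d)\<^sup>2 = (d\<^sup>2 + (v x - b)\<^sup>2) / d\<^sup>2"
        using d by (simp add: power_divide add_divide_distrib)
      then show ?thesis using d by (simp add: g1_def power2_eq_square)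
    qed
    moreover have "v1 x / (d\<^sup>2 + (v x - b)\<^sup>2) \<ge> 1"
      using v1_ge[OF that] pos' by simp
    ultimately show ?thesis
      using mult_left_mono[of 1 "v1 x / (d\<^sup>2 + (v x - b)\<^sup>2)" d] d by linarith
  qed
  \<comment> \<open>A stretch of length \<open>\<pi> / d\<close> is just long enough to exhaust the range of \<open>arctan\<close>.\<close>
  have "\<exists>z. X < z \<and> z < X + pi / d \<and> g (X + pi / d) - g X = (X + pi / d - X) * g1 z"
    by (rule MVT2) (use g1 d in auto)
  then obtain z where "X < z" "g (X + pi / d) - g X = pi / d * g1 z" by auto
  moreover have "pi / d * g1 z \<ge> pi / d * d"
    using g1_ge[of z] \<open>X < z\<close> d by (intro mult_left_mono) auto
  moreover have "g (X + pi / d) < pi / 2" "- (pi / 2) < g X"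
    unfolding g_def by (rule arctan_ubound, rule arctan_lbound)
  ultimately show False using d by simp
qed

section \<open>Signs and search mass for monotone profiles\<close>

lemma deriv_nonpos_if_antimono_on:
  fixes f :: "real \<Rightarrow> real"
  assumes "antimono_on S f" "(f has_real_derivative D) (at x within S)" "x \<in> S" "x islimpt S"
  shows "D \<le> 0"
proof (rule tendsto_upperbound)
  show "((\<lambda>y. (f y - f x) / (y - x)) \<longlongrightarrow> D) (at x within S)"
    using assms(2) by (simp add: has_field_derivative_iff)
  have "(f y - f x) / (y - x) \<le> 0" if "y \<in> S" "y \<noteq> x" for y
  proof (cases "x < y")
    case True
    then have "f y \<le> f x" using monotone_onD[OF assms(1), of x y] that assms(3) by simp
    with True show ?thesis by (simp add: divide_le_0_iff)
  next
    case False
    then have "f x \<le> f y" using monotone_onD[OF assms(1), of y x] that assms(3) by simp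
    with False show ?thesis by (simp add: divide_le_0_iff)
  qed
  then show "\<forall>\<^sub>F y in at x within S. (f y - f x) / (y - x) \<le> 0"
    by (auto simp: eventually_at_filter)
  show "at x within S \<noteq> bot"
    using assms(4) by (simp add: trivial_limit_within)
qed

lemma C2_onD:
  assumes "C2_on S f" "x \<in> S"
  shows "(f has_real_derivative Dx S f x) (at x within S)"
    and "(Dx S f has_real_derivative Dx S (Dx S f) x) (at x within S)"
proof -
  have "f differentiable (at x within S)" "Dx S f differentiable (at x within S)"
    using assms by (auto simp: C2_on_def differentiable_on_def)
  then show "(f has_real_derivative Dx S f x) (at x within S)"
    "(Dx S f has_real_derivative Dx S (Dx S f) x) (at x within S)"
    by (simp_all add: vector_derivative_works Dx_def has_real_derivative_iff_has_vector_derivative)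
qed

lemma C2_on_continuous:
  assumes "C2_on S f"
  shows "continuous_on S f" "continuous_on S (Dx S f)"
  using assms by (auto simp: C2_on_def intro: differentiable_imp_continuous_on)

lemma R_fun_nonneg:
  assumes "\<alpha> > 0" "mono_on S Q" "\<And>y. y \<in> S \<Longrightarrow> Dx S F y \<le> 0" "x \<in> S"
  shows "0 \<le> R_fun \<alpha> S F Q x"
proof -
  have "(Q y - Q x) * (- Dx S F y) \<ge> 0" if "y \<in> S \<inter> {x..}" for y
    using monotone_onD[OF assms(2), of x y] assms(3,4) that
    by (intro mult_nonneg_nonneg) auto
  then have "0 \<le> (LBINT y:S \<inter> {x..}. (Q y - Q x) * (- Dx S F y))"
    unfolding set_lebesgue_integral_def
    by (intro integral_nonneg_AE) (auto simp: indicator_def)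
  then show ?thesis using assms(1) by (simp add: R_fun_def)
qed

text \<open>
  Since \<open>-F'\<close> is a nonnegative density whose mass on \<open>[u, v]\<close> is the drop of \<open>F\<close>, the search mass is
  controlled by values of \<open>F\<close> alone.
\<close>

lemma search_mass_le:
  fixes F F1 s :: "real \<Rightarrow> real"
  assumes "u \<le> v"
    and F1: "\<And>x. x \<in> {u..v} \<Longrightarrow> (F has_real_derivative F1 x) (at x within {u..v})"
    and cont: "continuous_on {u..v} F1"
    and nonpos: "\<And>x. x \<in> {u..v} \<Longrightarrow> F1 x \<le> 0"
    and s: "\<And>x. x \<in> {u..v} \<Longrightarrow> s x \<le> \<sigma>"
    and int: "set_integrable lborel {u..v} (\<lambda>y. s y * (- F1 y))"
  shows "(LBINT y:{u..v}. s y * (- F1 y)) \<le> \<sigma> * (F u - F v)"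
proof -
  have F1_int: "set_integrable lborel {u..v} (\<lambda>y. \<sigma> * (- F1 y))"
    by (intro borel_integrable_atLeastAtMost' continuous_intros cont)
  have "(LBINT y:{u..v}. s y * (- F1 y)) \<le> (LBINT y:{u..v}. \<sigma> * (- F1 y))"
    by (rule set_integral_mono[OF int F1_int]) (intro mult_right_mono s; simp add: nonpos)
  also have "\<dots> = \<sigma> * (F u - F v)"
  proof -
    have "(LBINT y:{u..v}. \<sigma> * (- F1 y)) = (- \<sigma> * F v) - (- \<sigma> * F u)"
      unfolding set_lebesgue_integral_def
    proof (rule integral_FTC_atLeastAtMost[OF \<open>u \<le> v\<close>])
      show "((\<lambda>x. - \<sigma> * F x) has_vector_derivative \<sigma> * - F1 x) (at x within {u..v})"
        if "u \<le> x" "x \<le> v" for x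
        unfolding has_real_derivative_iff_has_vector_derivative[symmetric]
        by (rule derivative_eq_intros F1 refl | use that in simp)+
      show "continuous_on {u..v} (\<lambda>x. \<sigma> * - F1 x)"
        by (intro continuous_intros cont)
    qed
    then show ?thesis by (simp add: algebra_simps)
  qed
  finally show ?thesis .
qed

lemma set_integral_mono_set_nonneg:
  fixes g :: "real \<Rightarrow> real"
  assumes "set_integrable lborel B g" "A \<in> sets borel" "A \<subseteq> B" "\<And>x. x \<in> B \<Longrightarrow> 0 \<le> g x"
  shows "(LBINT x:A. g x) \<le> (LBINT x:B. g x)"
proof -
  have "set_integrable lborel A g" using set_integrable_subset[OF assms(1)] assms(2,3) by simp
  then show ?thesis
    using assms unfolding set_lebesgue_integral_def set_integrable_def
    by (intro integral_mono) (auto simp: indicator_def)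
qed

section \<open>The finite interval problem\<close>

context
  fixes \<kappa> \<alpha> \<rho> a c :: real and F Q s :: "real \<Rightarrow> real"
  assumes params: "\<kappa> > 0" "\<alpha> > 0" "a > 0"
    and sol: "finite_interval_solution \<kappa> \<alpha> \<rho> a c F Q s"
begin

lemma finite_C2: "C2_on {-a..a} F"
  using sol by (simp add: finite_interval_solution_def solves_system_def)

lemma finite_Dx_nonpos:
  assumes "x \<in> {-a..a}"
  shows "Dx {-a..a} F x \<le> 0"
proof (rule deriv_nonpos_if_antimono_on)
  show "antimono_on {-a..a} F" using sol by (simp add: finite_interval_solution_def)
  show "(F has_real_derivative Dx {-a..a} F x) (at x within {-a..a})"
    by (rule C2_onD[OF finite_C2 assms])
  show "x islimpt {-a..a}" using assms params by simp
qed (rule assms)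

lemma finite_search_bounds:
  assumes "x \<in> {-a..a}"
  shows "0 \<le> s x" "s x \<le> 1"
proof -
  have "s x = min 1 (R_fun \<alpha> {-a..a} F Q x)"
    using sol assms by (simp add: finite_interval_solution_def solves_system_def)
  moreover have "0 \<le> R_fun \<alpha> {-a..a} F Q x"
    by (rule R_fun_nonneg[OF params(2) _ finite_Dx_nonpos assms])
      (use sol in \<open>simp add: finite_interval_solution_def\<close>)
  ultimately show "0 \<le> s x" "s x \<le> 1" by auto
qed

lemma finite_mass_nonneg:
  assumes "x \<in> {-a..a}"
  shows "0 \<le> s x * (- Dx {-a..a} F x)"
  using finite_search_bounds(1) finite_Dx_nonpos assms by (intro mult_nonneg_nonneg) auto

lemma finite_mass_integrable:
  "set_integrable lborel {-a..a} (\<lambda>y. s y * (- Dx {-a..a} F y))"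
proof -
  have "set_integrable lborel ({-a..a} \<inter> {..a}) (\<lambda>y. s y * (- Dx {-a..a} F y))"
    using sol params unfolding finite_interval_solution_def solves_system_def by auto
  moreover have "{-a..a} \<inter> {..a} = {-a..a}" by auto
  ultimately show ?thesis by simp
qed

lemma finite_piece_le:
  assumes "-a \<le> u" "u \<le> v" "v \<le> a"
  shows "(LBINT y:{u..v}. s y * (- Dx {-a..a} F y)) \<le> F u - F v"
proof -
  have sub: "{u..v} \<subseteq> {-a..a}" using assms by auto
  have "(LBINT y:{u..v}. s y * (- Dx {-a..a} F y)) \<le> 1 * (F u - F v)"
  proof (rule search_mass_le[OF assms(2)])
    show "(F has_real_derivative Dx {-a..a} F x) (at x within {u..v})" if "x \<in> {u..v}" for x
      using C2_onD(1)[OF finite_C2, of x] that sub by (blast intro: DERIV_subset)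
    show "continuous_on {u..v} (Dx {-a..a} F)"
      by (rule continuous_on_subset[OF C2_on_continuous(2)[OF finite_C2] sub])
    show "set_integrable lborel {u..v} (\<lambda>y. s y * (- Dx {-a..a} F y))"
      by (rule set_integrable_subset[OF finite_mass_integrable]) (use sub in auto)
  qed (use finite_Dx_nonpos finite_search_bounds sub in auto)
  then show ?thesis by simp
qed

text \<open>
  This is the tightness estimate for the limit \<open>a \<rightarrow> \<infinity>\<close>: the outer terms involve \<open>F\<close> only at
  \<open>\<plusminus>X\<close>, where it converges, and are small for large \<open>X\<close> because the limit profile tends to \<open>1\<close>
  and \<open>0\<close> at the two ends.
\<close>

lemma finite_mass_tail_bound:
  assumes "0 < X" "X \<le> a"
  shows "(LBINT y:{-a..a}. s y * (- Dx {-a..a} F y))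
    \<le> (1 - F (-X)) + (LBINT y:{-X..X}. s y * (- Dx {-a..a} F y)) + F X"
proof -
  let ?g = "\<lambda>y. s y * (- Dx {-a..a} F y)"
  have int: "set_integrable lborel {u..v} ?g" if "-a \<le> u" "v \<le> a" for u v
    by (rule set_integrable_subset[OF finite_mass_integrable]) (use that in auto)
  have "(LBINT y:{-a..a}. ?g y)
      \<le> (LBINT y:{-a..-X}. ?g y) + (LBINT y:{-X..X}. ?g y) + (LBINT y:{X..a}. ?g y)"
  proof -
    have i: "integrable lborel (\<lambda>y. indicator {-a..a} y *\<^sub>R ?g y)"
      "integrable lborel (\<lambda>y. indicator {-a..-X} y *\<^sub>R ?g y)"
      "integrable lborel (\<lambda>y. indicator {-X..X} y *\<^sub>R ?g y)"
      "integrable lborel (\<lambda>y. indicator {X..a} y *\<^sub>R ?g y)"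
      using int[of "-a" a] int[of "-a" "-X"] int[of "-X" X] int[of X a] assms
      by (auto simp: set_integrable_def)
    have "(\<integral>y. indicator {-a..a} y *\<^sub>R ?g y \<partial>lborel)
      \<le> (\<integral>y. indicator {-a..-X} y *\<^sub>R ?g y + indicator {-X..X} y *\<^sub>R ?g y
            + indicator {X..a} y *\<^sub>R ?g y \<partial>lborel)"
    proof (rule integral_mono)
      show "indicator {-a..a} y *\<^sub>R ?g y \<le> indicator {-a..-X} y *\<^sub>R ?g y
          + indicator {-X..X} y *\<^sub>R ?g y + indicator {X..a} y *\<^sub>R ?g y" for y
        using finite_mass_nonneg[of y] assms by (auto simp: indicator_def)
    qed (intro Bochner_Integration.integrable_add i)+
    also have "\<dots> = (\<integral>y. indicator {-a..-X} y *\<^sub>R ?g y \<partial>lborel)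
      + (\<integral>y. indicator {-X..X} y *\<^sub>R ?g y \<partial>lborel) + (\<integral>y. indicator {X..a} y *\<^sub>R ?g y \<partial>lborel)"
      using i by (simp add: Bochner_Integration.integral_add del: real_scaleR_def)
    finally show ?thesis by (simp only: set_lebesgue_integral_def)
  qed
  moreover have "(LBINT y:{-a..-X}. ?g y) \<le> F (-a) - F (-X)"
    by (rule finite_piece_le) (use assms in auto)
  moreover have "(LBINT y:{X..a}. ?g y) \<le> F X - F a"
    by (rule finite_piece_le) (use assms in auto)
  moreover have "F (-a) = 1" "F a = 0" using sol by (auto simp: finite_interval_solution_def)
  ultimately show ?thesis by linarith
qed

text \<open>
  The assumption says that \<open>w(x) = exp (c x / (2 \<kappa>)) F(x)\<close> is smaller at \<open>-a\<close> than at \<open>0\<close>; it holds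
  for all large \<open>a\<close> when the speeds converge to a positive limit. The integral over \<open>[-a, x]\<close> is at
  most the one over \<open>[-a, a]\<close>, which bounds the coefficient \<open>J\<close>.
\<close>

lemma finite_speed_bound:
  assumes "exp (- (c * a / (2 * \<kappa>))) < 1 / 2"
  shows "c\<^sup>2 < 4 * \<kappa> * (\<alpha> * (LBINT y:{-a..a}. s y * (- Dx {-a..a} F y)))"
proof (rule dirichlet_front_speed_bound[where f = F and ?f1.0 = "Dx {-a..a} F"
      and ?f2.0 = "Dx {-a..a} (Dx {-a..a} F)"
      and J = "\<lambda>x. \<alpha> * (LBINT y:{-a..a} \<inter> {..x}. s y * (- Dx {-a..a} F y))"])
  have bc: "F (-a) = 1" "F a = 0" "F 0 = 1 / 2" "antimono_on {-a..a} F"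
    using sol by (auto simp: finite_interval_solution_def)
  show "exp (- (c * a / (2 * \<kappa>))) * F (-a) < F 0" "F a = 0" "F 0 > 0"
    using assms bc by auto
  fix x assume x: "-a < x" "x < a"
  then have xin: "x \<in> {-a..a}" by simp
  have at: "at x within {-a..a} = at x"
    by (rule at_within_interior) (use x in simp)
  show "(F has_real_derivative Dx {-a..a} F x) (at x)"
    "(Dx {-a..a} F has_real_derivative Dx {-a..a} (Dx {-a..a} F) x) (at x)"
    using C2_onD[OF finite_C2 xin] by (simp_all add: at)
  show "- c * Dx {-a..a} F x - \<kappa> * Dx {-a..a} (Dx {-a..a} F) x
      = F x * (\<alpha> * (LBINT y:{-a..a} \<inter> {..x}. s y * (- Dx {-a..a} F y)))"
    using sol xin unfolding finite_interval_solution_def solves_system_def by auto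
  show "0 \<le> F x"
    using monotone_onD[OF bc(4) xin, of a] bc x by simp
  show "\<alpha> * (LBINT y:{-a..a} \<inter> {..x}. s y * (- Dx {-a..a} F y))
      \<le> \<alpha> * (LBINT y:{-a..a}. s y * (- Dx {-a..a} F y))"
    by (intro mult_left_mono set_integral_mono_set_nonneg finite_mass_integrable
        finite_mass_nonneg) (use params in auto)
qed (use params C2_on_continuous[OF finite_C2] in auto)

end

section \<open>Monotone traveling waves on the line\<close>

context
  fixes \<kappa> \<alpha> \<rho> c :: real and F Q s :: "real \<Rightarrow> real"
  assumes params: "\<kappa> > 0" "\<alpha> > 0"
    and wave: "traveling_wave \<kappa> \<alpha> \<rho> c F Q s"
    and mono: "antimono F" "mono Q"
begin

lemma wave_C2: "C2_on UNIV F"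
  using wave by (simp add: traveling_wave_def solves_system_def)

lemma wave_limits: "(F \<longlongrightarrow> 1) at_bot" "(F \<longlongrightarrow> 0) at_top"
  using wave by (simp_all add: traveling_wave_def)

lemma wave_nonneg: "0 \<le> F x"
proof (rule tendsto_upperbound[OF wave_limits(2)])
  show "\<forall>\<^sub>F y in at_top. F y \<le> F x"
    using mono(1) by (auto simp: eventually_at_top_linorder intro!: exI[of _ x] dest: antimonoD)
qed simp

lemma wave_Dx_nonpos: "Dx UNIV F x \<le> 0"
  by (rule deriv_nonpos_if_antimono_on[OF mono(1) C2_onD(1)[OF wave_C2]]) auto

lemma wave_search_eq: "s x = min 1 (R_fun \<alpha> UNIV F Q x)"
  using wave by (simp add: traveling_wave_def solves_system_def)

lemma wave_search_bounds: "0 \<le> s x" "s x \<le> 1"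
  using R_fun_nonneg[OF params(2) mono(2) wave_Dx_nonpos, of x] wave_search_eq[of x] by auto

lemma wave_mass_nonneg: "0 \<le> s x * (- Dx UNIV F x)"
  using wave_search_bounds(1) wave_Dx_nonpos by (intro mult_nonneg_nonneg) auto

lemma wave_Dx_integral:
  "integrable lborel (\<lambda>x. - Dx UNIV F x)" "(\<integral>x. - Dx UNIV F x \<partial>lborel) = 1"
proof -
  have "isCont (Dx UNIV F) x" for x
    using C2_on_continuous(2)[OF wave_C2] by (simp add: continuous_on_eq_continuous_at)
  then have c: "isCont (\<lambda>x. - Dx UNIV F x) x" for x by simp
  have d: "((\<lambda>x. - F x) has_real_derivative - Dx UNIV F x) (at x)" for x
    using C2_onD(1)[OF wave_C2, of x] by (simp add: DERIV_minus)
  have l: "(((\<lambda>x. - F x) \<circ> real_of_ereal) \<longlongrightarrow> - 1) (at_right (- \<infinity>))"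
    "(((\<lambda>x. - F x) \<circ> real_of_ereal) \<longlongrightarrow> 0) (at_left \<infinity>)"
    using tendsto_minus[OF wave_limits(1)] tendsto_minus[OF wave_limits(2)]
    by (simp_all add: ereal_tendsto_simps)
  note ftc = interval_integral_FTC_nonneg[of "-\<infinity>" "\<infinity>" "\<lambda>x. - F x" "\<lambda>x. - Dx UNIV F x", OF _ d c _ l]
  show "integrable lborel (\<lambda>x. - Dx UNIV F x)"
    using ftc(1) wave_Dx_nonpos by (simp add: set_integrable_def)
  show "(\<integral>x. - Dx UNIV F x \<partial>lborel) = 1"
    using ftc(2) wave_Dx_nonpos
    by (simp add: interval_lebesgue_integral_def set_lebesgue_integral_def)
qed

lemma wave_mass_integrable_le: "set_integrable lborel {..x} (\<lambda>y. s y * (- Dx UNIV F y))"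
  using wave unfolding traveling_wave_def solves_system_def by auto

text \<open>
  The density is dominated by \<open>-F'\<close>. Its measurability on the whole line comes from that of its
  restrictions to \<open>(-\<infinity>, n]\<close>, which are integrable by assumption.
\<close>

lemma wave_mass_integrable: "integrable lborel (\<lambda>y. s y * (- Dx UNIV F y))"
proof (rule Bochner_Integration.integrable_bound[OF wave_Dx_integral(1)])
  let ?g = "\<lambda>y. s y * (- Dx UNIV F y)"
  show "?g \<in> borel_measurable lborel"
  proof (rule borel_measurable_LIMSEQ_real)
    show "(\<lambda>n. indicator {..real n} y *\<^sub>R ?g y) \<longlonglongrightarrow> ?g y" for y
    proof (rule tendsto_eventually)
      have "\<forall>\<^sub>F n in sequentially. y \<le> real n"
        using filterlim_real_sequentially by (simp add: filterlim_at_top)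
      then show "\<forall>\<^sub>F n in sequentially. indicator {..real n} y *\<^sub>R ?g y = ?g y"
        by eventually_elim simp
    qed
    show "(\<lambda>y. indicator {..real n} y *\<^sub>R ?g y) \<in> borel_measurable lborel" for n
      using wave_mass_integrable_le[of "real n"] by (simp add: set_integrable_def)
  qed
  have "norm (?g y) \<le> norm (- Dx UNIV F y)" for y
    using wave_search_bounds[of y] mult_right_mono[of "s y" 1 "\<bar>Dx UNIV F y\<bar>"]
    by (simp add: abs_mult)
  then show "AE y in lborel. norm (?g y) \<le> norm (- Dx UNIV F y)" by simp
qed

lemma wave_ode:
  "- c * Dx UNIV F x - \<kappa> * Dx UNIV (Dx UNIV F) x
     = F x * (\<alpha> * (LBINT y:{..x}. s y * (- Dx UNIV F y)))"
  using wave unfolding traveling_wave_def solves_system_def by auto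

lemma wave_partial_mass_nonneg: "0 \<le> (LBINT y:{..x}. s y * (- Dx UNIV F y))"
  unfolding set_lebesgue_integral_def
  using wave_mass_nonneg by (intro integral_nonneg_AE) (auto simp: indicator_def)

lemma wave_positive: "0 < F x"
proof (rule front_positive[where f = F and ?f1.0 = "Dx UNIV F" and ?f2.0 = "Dx UNIV (Dx UNIV F)" and c = c
      and J = "\<lambda>x. \<alpha> * (LBINT y:{..x}. s y * (- Dx UNIV F y))"])
  show "0 \<le> \<alpha> * (LBINT y:{..x}. s y * (- Dx UNIV F y))" for x
    using wave_partial_mass_nonneg params by simp
qed (use params wave_limits wave_nonneg wave_ode C2_onD[OF wave_C2] in auto)

text \<open>
  To the right of \<open>X\<close> the coefficient \<open>J\<close> is at least its value at \<open>X\<close>, so the exact inequality holds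
  with the mass of \<open>(-\<infinity>, X]\<close> in place of \<open>\<gamma>\<close>; then \<open>X \<rightarrow> \<infinity>\<close>.
\<close>

lemma wave_speed_ge: "4 * \<kappa> * (\<alpha> * (LBINT y. s y * (- Dx UNIV F y))) \<le> c\<^sup>2"
proof (rule tendsto_upperbound)
  show "((\<lambda>X. 4 * \<kappa> * (\<alpha> * (LBINT y:{..X}. s y * (- Dx UNIV F y))))
    \<longlongrightarrow> 4 * \<kappa> * (\<alpha> * (LBINT y. s y * (- Dx UNIV F y)))) at_top"
    unfolding set_lebesgue_integral_def
    by (intro tendsto_intros tendsto_integral_at_top wave_mass_integrable) simp
  have "4 * \<kappa> * (\<alpha> * (LBINT y:{..X}. s y * (- Dx UNIV F y))) \<le> c\<^sup>2" for X
  proof (rule speed_bound_if_positive[where X = X and f = F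
        and ?f1.0 = "Dx UNIV F" and ?f2.0 = "Dx UNIV (Dx UNIV F)"
        and J = "\<lambda>x. \<alpha> * (LBINT y:{..x}. s y * (- Dx UNIV F y))"])
    show "\<alpha> * (LBINT y:{..X}. s y * (- Dx UNIV F y))
      \<le> \<alpha> * (LBINT y:{..x}. s y * (- Dx UNIV F y))" if "X \<le> x" for x
      using that params
      by (intro mult_left_mono set_integral_mono_set_nonneg wave_mass_integrable_le
          wave_mass_nonneg) auto
  qed (use params wave_positive wave_ode C2_onD[OF wave_C2] in auto)
  then show "\<forall>\<^sub>F X in at_top. 4 * \<kappa> * (\<alpha> * (LBINT y:{..X}. s y * (- Dx UNIV F y))) \<le> c\<^sup>2"
    by simp
qed simp

text \<open>
  As \<open>Q\<close> increases, the integral in \<open>R(x)\<close> is at most its value \<open>K\<close> at \<open>x = 0\<close> for every \<open>x \<ge> 0\<close>,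
  whence \<open>R(x) \<le> (\<alpha> / 2) K exp (-x)\<close>.
\<close>

lemma wave_search_eventually_le_half: "\<forall>\<^sub>F x in at_top. s x \<le> 1 / 2"
proof -
  define K where "K = (LBINT y:{0..}. (Q y - Q 0) * (- Dx UNIV F y))"
  have int: "set_integrable lborel {x..} (\<lambda>y. (Q y - Q x) * (- Dx UNIV F y))" for x
    using wave by (simp add: traveling_wave_def solves_system_def)
  have le: "R_fun \<alpha> UNIV F Q x \<le> \<alpha> / 2 * exp (- x) * K" if "0 \<le> x" for x
  proof -
    have "(LBINT y:{x..}. (Q y - Q x) * (- Dx UNIV F y)) \<le> K"
      unfolding K_def set_lebesgue_integral_def
    proof (rule integral_mono)
      show "integrable lborel (\<lambda>y. indicator {x..} y *\<^sub>R ((Q y - Q x) * - Dx UNIV F y))"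
        "integrable lborel (\<lambda>y. indicator {0..} y *\<^sub>R ((Q y - Q 0) * - Dx UNIV F y))"
        using int by (simp_all only: set_integrable_def)
      fix y
      have "(Q y - Q x) * - Dx UNIV F y \<le> (Q y - Q 0) * - Dx UNIV F y"
        using monoD[OF mono(2) that] wave_Dx_nonpos by (intro mult_right_mono) auto
      moreover have "0 \<le> (Q y - Q 0) * - Dx UNIV F y" if "0 \<le> y"
        using monoD[OF mono(2) that] wave_Dx_nonpos by (intro mult_nonneg_nonneg) auto
      ultimately show "indicator {x..} y *\<^sub>R ((Q y - Q x) * - Dx UNIV F y)
        \<le> indicator {0..} y *\<^sub>R ((Q y - Q 0) * - Dx UNIV F y)"
        using that by (auto simp: indicator_def)
    qed
    then show ?thesis
      using params by (simp add: R_fun_def mult_left_mono)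
  qed
  have "((\<lambda>x. exp (- x)) \<longlongrightarrow> (0::real)) at_top"
    by (rule filterlim_compose[OF exp_at_bot filterlim_uminus_at_bot_at_top])
  then have "((\<lambda>x. \<alpha> / 2 * exp (- x) * K) \<longlongrightarrow> \<alpha> / 2 * 0 * K) at_top"
    by (intro tendsto_intros)
  then have "((\<lambda>x. \<alpha> / 2 * exp (- x) * K) \<longlongrightarrow> 0) at_top"
    by simp
  then have "\<forall>\<^sub>F x in at_top. \<alpha> / 2 * exp (- x) * K < 1 / 2"
    by (rule order_tendstoD) simp
  then show ?thesis
    using eventually_ge_at_top[of 0]
  proof eventually_elim
    case (elim x)
    then show ?case using le[of x] wave_search_eq[of x] by simp
  qed
qed

text \<open>
  \<open>1 - \<gamma> = \<integral> (1 - s) (-F')\<close>, and on an interval \<open>[u, v]\<close> far to the right the integrand is at least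
  \<open>-F'/2\<close>. Positivity of \<open>F\<close> together with its limit \<open>0\<close> yields such an interval with
  \<open>F(v) < F(u)\<close>.
\<close>

lemma wave_mass_less_one: "(LBINT y. s y * (- Dx UNIV F y)) < 1"
proof -
  obtain u where u: "\<And>x. u \<le> x \<Longrightarrow> s x \<le> 1 / 2"
    using wave_search_eventually_le_half by (auto simp: eventually_at_top_linorder)
  have "\<forall>\<^sub>F x in at_top. F x < F u"
    by (rule order_tendstoD(2)[OF wave_limits(2) wave_positive])
  then have "\<forall>\<^sub>F x in at_top. F x < F u \<and> u \<le> x"
    using eventually_ge_at_top by (rule eventually_conj)
  then obtain v where v: "F v < F u" "u \<le> v"
    by (auto simp: eventually_at_top_linorder)
  let ?F1 = "Dx UNIV F"
  have cont: "continuous_on {u..v} ?F1"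
    by (rule continuous_on_subset[OF C2_on_continuous(2)[OF wave_C2]]) simp
  have i: "integrable lborel (\<lambda>y. indicator {u..v} y *\<^sub>R (- (1/2) * ?F1 y))"
    unfolding set_integrable_def[symmetric]
    by (intro borel_integrable_atLeastAtMost' continuous_intros cont)
  have "(\<integral>y. indicator {u..v} y *\<^sub>R (- (1/2) * ?F1 y) \<partial>lborel) = - (1/2) * F v - - (1/2) * F u"
  proof (rule integral_FTC_atLeastAtMost[OF v(2)])
    show "((\<lambda>x. - (1/2) * F x) has_vector_derivative - (1/2) * ?F1 x) (at x within {u..v})" for x
      unfolding has_real_derivative_iff_has_vector_derivative[symmetric]
      by (rule derivative_eq_intros DERIV_subset[OF C2_onD(1)[OF wave_C2]] refl | simp)+
    show "continuous_on {u..v} (\<lambda>x. - (1/2) * ?F1 x)"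
      by (intro continuous_intros cont)
  qed
  moreover have "(\<integral>y. indicator {u..v} y *\<^sub>R (- (1/2) * ?F1 y) \<partial>lborel)
      \<le> (\<integral>y. - ?F1 y - s y * (- ?F1 y) \<partial>lborel)"
  proof (rule integral_mono[OF i])
    show "integrable lborel (\<lambda>y. - ?F1 y - s y * (- ?F1 y))"
      by (rule Bochner_Integration.integrable_diff[OF wave_Dx_integral(1) wave_mass_integrable])
    show "indicator {u..v} y *\<^sub>R (- (1/2) * ?F1 y) \<le> - ?F1 y - s y * (- ?F1 y)" for y
    proof -
      have "s y * (- ?F1 y) \<le> 1 / 2 * (- ?F1 y)" if "u \<le> y"
        using u[OF that] wave_Dx_nonpos[of y] by (intro mult_right_mono) auto
      moreover have "s y * (- ?F1 y) \<le> 1 * (- ?F1 y)"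
        using wave_search_bounds[of y] wave_Dx_nonpos[of y] by (intro mult_right_mono) auto
      ultimately show ?thesis by (auto simp: indicator_def)
    qed
  qed
  moreover have "(\<integral>y. - ?F1 y - s y * (- ?F1 y) \<partial>lborel) = 1 - (LBINT y. s y * (- ?F1 y))"
    using Bochner_Integration.integral_diff[OF wave_Dx_integral(1) wave_mass_integrable]
    by (simp only: wave_Dx_integral(2))
  ultimately show ?thesis using v(1) by linarith
qed

end

section \<open>Passing to the limit\<close>

lemma mass_on_compact_converges:
  fixes g :: "real \<Rightarrow> real" and f :: "nat \<Rightarrow> real \<Rightarrow> real"
  assumes "\<And>x. x \<in> {u..v} \<Longrightarrow> (\<lambda>n. s n x) \<longlonglongrightarrow> t x"
    and lim: "uniform_limit {u..v} f g sequentially"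
    and cont: "continuous_on {u..v} g"
    and int: "\<forall>\<^sub>F n in sequentially. set_integrable lborel {u..v} (\<lambda>y. s n y * (- f n y))"
    and int': "set_integrable lborel {u..v} (\<lambda>y. t y * (- g y))"
    and s: "\<forall>\<^sub>F n in sequentially. \<forall>x\<in>{u..v}. \<bar>s n x\<bar> \<le> 1"
  shows "(\<lambda>n. LBINT y:{u..v}. s n y * (- f n y)) \<longlonglongrightarrow> (LBINT y:{u..v}. t y * (- g y))"
proof -
  have "bounded (g ` {u..v})"
    by (intro compact_imp_bounded compact_continuous_image cont) simp
  then obtain M where M: "\<And>x. x \<in> {u..v} \<Longrightarrow> \<bar>g x\<bar> \<le> M"
    unfolding bounded_iff real_norm_def by blast
  have "\<forall>\<^sub>F n in sequentially. \<forall>x\<in>{u..v}. dist (f n x) (g x) < 1"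
    using lim by (rule uniform_limitD) simp
  with int s have "\<forall>\<^sub>F n in sequentially. set_integrable lborel {u..v} (\<lambda>y. s n y * (- f n y))
      \<and> (\<forall>x\<in>{u..v}. \<bar>s n x * (- f n x)\<bar> \<le> M + 1)"
  proof eventually_elim
    case (elim n)
    have "\<bar>s n x * (- f n x)\<bar> \<le> M + 1" if x: "x \<in> {u..v}" for x
    proof -
      have "\<bar>f n x\<bar> \<le> M + 1" using elim(3) M[OF x] x by (force simp: dist_real_def)
      moreover have "\<bar>s n x\<bar> \<le> 1" using elim(2) x by blast
      ultimately have "\<bar>s n x\<bar> * \<bar>f n x\<bar> \<le> 1 * (M + 1)" by (intro mult_mono) auto
      then show ?thesis by (simp add: abs_mult)
    qed
    with elim(1) show ?case by blast
  qed
  then obtain N where N: "\<And>n. N \<le> n \<Longrightarrow> set_integrable lborel {u..v} (\<lambda>y. s n y * (- f n y))"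
    "\<And>n x. N \<le> n \<Longrightarrow> x \<in> {u..v} \<Longrightarrow> \<bar>s n x * (- f n x)\<bar> \<le> M + 1"
    unfolding eventually_sequentially by blast
  \<comment> \<open>The bound \<open>M + 1\<close> holds only from index \<open>N\<close> on, hence the shifted sequence.\<close>
  have "(\<lambda>n. LBINT y:{u..v}. s (n + N) y * (- f (n + N) y)) \<longlonglongrightarrow> (LBINT y:{u..v}. t y * (- g y))"
    unfolding set_lebesgue_integral_def
  proof (rule integral_dominated_convergence[where w = "\<lambda>y. indicator {u..v} y *\<^sub>R (M + 1)"])
    show "integrable lborel (\<lambda>y. indicator {u..v} y *\<^sub>R (M + 1))"
      using borel_integrable_atLeastAtMost'[of u v "\<lambda>_. M + 1"]
      by (simp only: set_integrable_def) simp
    show "(\<lambda>y. indicator {u..v} y *\<^sub>R (t y * - g y)) \<in> borel_measurable lborel"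
      using int' unfolding set_integrable_def by (rule borel_measurable_integrable)
    show "(\<lambda>y. indicator {u..v} y *\<^sub>R (s (n + N) y * - f (n + N) y)) \<in> borel_measurable lborel" for n
      using N(1)[of "n + N"] unfolding set_integrable_def by (intro borel_measurable_integrable) simp
    show "AE y in lborel. norm (indicator {u..v} y *\<^sub>R (s (n + N) y * - f (n + N) y))
        \<le> indicator {u..v} y *\<^sub>R (M + 1)" for n
      using N(2)[of "n + N"] by (auto simp: indicator_def)
    have "(\<lambda>n. indicator {u..v} y *\<^sub>R (s (n + N) y * - f (n + N) y))
        \<longlonglongrightarrow> indicator {u..v} y *\<^sub>R (t y * - g y)" for y
    proof (cases "y \<in> {u..v}")
      case True
      have "(\<lambda>n. s n y * - f n y) \<longlonglongrightarrow> t y * - g y"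
        by (intro tendsto_intros assms(1) tendsto_uniform_limitI[OF lim] True)
      then show ?thesis using True LIMSEQ_ignore_initial_segment by force
    qed simp
    then show "AE y in lborel. (\<lambda>n. indicator {u..v} y *\<^sub>R (s (n + N) y * - f (n + N) y))
        \<longlonglongrightarrow> indicator {u..v} y *\<^sub>R (t y * - g y)" by simp
  qed
  then show ?thesis by (rule LIMSEQ_offset)
qed

text \<open>
  On \<open>[-a, a]\<close> with \<open>a\<close> large one has \<open>c\<^sub>a\<^sup>2 < 4 \<kappa> \<alpha> \<gamma>\<^sub>a\<close>, so the limits \<open>a \<rightarrow> \<infinity>\<close> at fixed \<open>X\<close> and
  then \<open>X \<rightarrow> \<infinity>\<close> give the claim. Only an upper bound for the limit of \<open>\<gamma>\<^sub>a\<close> is at stake.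
\<close>

lemma constructed_wave_speed_le:
  assumes "\<kappa> > 0" "\<alpha> > 0" and cw: "constructed_traveling_wave \<kappa> \<alpha> \<rho> c F Q s"
  shows "c\<^sup>2 \<le> 4 * \<kappa> * (\<alpha> * (LBINT y. s y * (- Dx UNIV F y)))"
proof -
  have wave: "traveling_wave \<kappa> \<alpha> \<rho> c F Q s" "antimono F" "mono Q" and "0 < c"
    using cw by (auto simp: constructed_traveling_wave_def)
  note w = assms(1,2) wave
  obtain a ca Fa Qa sa where a: "\<And>n. a n > 0" "filterlim a at_top sequentially"
    and sol: "\<And>n. finite_interval_solution \<kappa> \<alpha> \<rho> (a n) (ca n) (Fa n) (Qa n) (sa n)"
    and lim: "ca \<longlonglongrightarrow> c" "C2_loc_limit a Fa F" "\<And>x. (\<lambda>n. sa n x) \<longlonglongrightarrow> s x"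
    using cw unfolding constructed_traveling_wave_def by blast
  define \<gamma> where "\<gamma> = (LBINT y. s y * (- Dx UNIV F y))"
  define \<gamma>a where "\<gamma>a n = (LBINT y:{-a n..a n}. sa n y * (- Dx {-a n..a n} (Fa n) y))" for n
  have "filterlim (\<lambda>n. ca n / (2 * \<kappa>) * a n) at_top sequentially"
  proof (rule filterlim_tendsto_pos_mult_at_top[OF _ _ a(2)])
    show "(\<lambda>n. ca n / (2 * \<kappa>)) \<longlonglongrightarrow> c / (2 * \<kappa>)"
      by (intro tendsto_intros lim(1)) (use assms in simp)
    show "0 < c / (2 * \<kappa>)" using assms \<open>0 < c\<close> by simp
  qed
  then have "((\<lambda>n. exp (- (ca n * a n / (2 * \<kappa>)))) \<longlongrightarrow> 0) sequentially"
    by (intro filterlim_compose[OF exp_at_bot])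
      (simp add: filterlim_uminus_at_bot)
  then have ev1: "\<forall>\<^sub>F n in sequentially. exp (- (ca n * a n / (2 * \<kappa>))) < 1 / 2"
    by (rule order_tendstoD) simp
  have bound: "c\<^sup>2 \<le> 4 * \<kappa> * (\<alpha> * ((1 - F (-X)) + \<gamma> + F X))" if X: "X > 0" for X
  proof -
    have ev2: "\<forall>\<^sub>F n in sequentially. X \<le> a n"
      using a(2) by (simp add: filterlim_at_top)
    have unif: "uniform_limit {-X..X} Fa F sequentially"
      "uniform_limit {-X..X} (\<lambda>n. Dx {-a n..a n} (Fa n)) (Dx UNIV F) sequentially"
      using lim(2) by (auto simp: C2_loc_limit_def)
    have int: "set_integrable lborel {-X..X} (\<lambda>y. s y * (- Dx UNIV F y))"
      by (rule set_integrable_subset[OF wave_mass_integrable_le[OF w, of X]]) auto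
    have mid: "(\<lambda>n. LBINT y:{-X..X}. sa n y * (- Dx {-a n..a n} (Fa n) y))
        \<longlonglongrightarrow> (LBINT y:{-X..X}. s y * (- Dx UNIV F y))"
    proof (rule mass_on_compact_converges[OF lim(3) unif(2) _ _ int])
      show "continuous_on {-X..X} (Dx UNIV F)"
        by (rule continuous_on_subset[OF C2_on_continuous(2)[OF wave_C2[OF w]]]) simp
      show "\<forall>\<^sub>F n in sequentially.
          set_integrable lborel {-X..X} (\<lambda>y. sa n y * (- Dx {-a n..a n} (Fa n) y))"
        using ev2
      proof eventually_elim
        case (elim n)
        show ?case
          by (rule set_integrable_subset[OF finite_mass_integrable[OF assms(1,2) a(1) sol]])
            (use elim in auto)
      qed
      show "\<forall>\<^sub>F n in sequentially. \<forall>x\<in>{-X..X}. \<bar>sa n x\<bar> \<le> 1"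
        using ev2
      proof eventually_elim
        case (elim n)
        then show ?case using finite_search_bounds[OF assms(1,2) a(1) sol] by (force simp: abs_le_iff)
      qed
    qed
    have Flim: "(\<lambda>n. Fa n (-X)) \<longlonglongrightarrow> F (-X)" "(\<lambda>n. Fa n X) \<longlonglongrightarrow> F X"
      by (rule tendsto_uniform_limitI[OF unif(1)]; use X in simp)+
    have "\<forall>\<^sub>F n in sequentially. (ca n)\<^sup>2 \<le> 4 * \<kappa> * (\<alpha> * ((1 - Fa n (-X))
        + (LBINT y:{-X..X}. sa n y * (- Dx {-a n..a n} (Fa n) y)) + Fa n X))"
      using ev1 ev2
    proof eventually_elim
      case (elim n)
      note fin = assms(1,2) a(1) sol
      have "(ca n)\<^sup>2 < 4 * \<kappa> * (\<alpha> * \<gamma>a n)"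
        unfolding \<gamma>a_def by (rule finite_speed_bound[OF fin elim(1)])
      also have "\<dots> \<le> 4 * \<kappa> * (\<alpha> * ((1 - Fa n (-X))
        + (LBINT y:{-X..X}. sa n y * (- Dx {-a n..a n} (Fa n) y)) + Fa n X))"
        unfolding \<gamma>a_def
        by (intro mult_left_mono finite_mass_tail_bound[OF fin X elim(2)]) (use assms in auto)
      finally show ?case by simp
    qed
    then have "c\<^sup>2 \<le> 4 * \<kappa> * (\<alpha> * ((1 - F (-X))
        + (LBINT y:{-X..X}. s y * (- Dx UNIV F y)) + F X))"
      by (rule tendsto_le[OF sequentially_bot, rotated 2]) (intro tendsto_intros lim(1) mid Flim)+
    also have "\<dots> \<le> 4 * \<kappa> * (\<alpha> * ((1 - F (-X)) + \<gamma> + F X))"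
    proof -
      have "(LBINT y:{-X..X}. s y * (- Dx UNIV F y)) \<le> (LBINT y:UNIV. s y * (- Dx UNIV F y))"
        by (rule set_integral_mono_set_nonneg)
          (use wave_mass_integrable[OF w] wave_mass_nonneg[OF w] in \<open>auto simp: set_integrable_def\<close>)
      then have "(LBINT y:{-X..X}. s y * (- Dx UNIV F y)) \<le> \<gamma>"
        by (simp add: \<gamma>_def set_lebesgue_integral_def)
      then show ?thesis using assms by (intro mult_left_mono) auto
    qed
    finally show ?thesis .
  qed
  have "c\<^sup>2 \<le> 4 * \<kappa> * (\<alpha> * ((1 - 1) + \<gamma> + 0))"
  proof (rule tendsto_lowerbound)
    show "((\<lambda>X. 4 * \<kappa> * (\<alpha> * ((1 - F (-X)) + \<gamma> + F X)))
        \<longlongrightarrow> 4 * \<kappa> * (\<alpha> * ((1 - 1) + \<gamma> + 0))) at_top"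
      by (intro tendsto_intros wave_limits(2)[OF w]
          filterlim_compose[OF wave_limits(1)[OF w] filterlim_uminus_at_bot_at_top])
    show "\<forall>\<^sub>F X in at_top. c\<^sup>2 \<le> 4 * \<kappa> * (\<alpha> * ((1 - F (-X)) + \<gamma> + F X))"
      using eventually_gt_at_top[of 0] by eventually_elim (rule bound)
  qed simp
  then show ?thesis by (simp add: \<gamma>_def)
qed

theorem proposition1p2:
  fixes \<kappa> :: real
  assumes "\<kappa> > 0"
  shows "\<exists>\<alpha>0>0. \<forall>\<alpha>>\<alpha>0. \<exists>\<rho>0>0. \<forall>\<rho>>\<rho>0. \<forall>c F Q s \<gamma>.
           constructed_traveling_wave \<kappa> \<alpha> \<rho> c F Q s \<longrightarrow>
           \<gamma> = (LBINT y. s y * (- Dx UNIV F y)) \<longrightarrow>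
           c = 2 * sqrt (\<kappa> * \<alpha> * \<gamma>) \<and> \<gamma> < 1"
proof -
  have main: "c = 2 * sqrt (\<kappa> * \<alpha> * \<gamma>) \<and> \<gamma> < 1"
    if "\<alpha> > 1" and cw: "constructed_traveling_wave \<kappa> \<alpha> \<rho> c F Q s"
      and \<gamma>: "\<gamma> = (LBINT y. s y * (- Dx UNIV F y))" for \<alpha> \<rho> c F Q s \<gamma>
  proof -
    have \<alpha>: "\<alpha> > 0" using that by simp
    have wave: "traveling_wave \<kappa> \<alpha> \<rho> c F Q s" "antimono F" "mono Q" and "0 < c"
      using cw by (auto simp: constructed_traveling_wave_def)
    have "c\<^sup>2 = 4 * \<kappa> * (\<alpha> * \<gamma>)"
      using wave_speed_ge[OF assms \<alpha> wave] constructed_wave_speed_le[OF assms \<alpha> cw]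
      unfolding \<gamma> by linarith
    then have "c\<^sup>2 = 2\<^sup>2 * (\<kappa> * \<alpha> * \<gamma>)" by simp
    then have "sqrt (c\<^sup>2) = 2 * sqrt (\<kappa> * \<alpha> * \<gamma>)"
      by (simp add: real_sqrt_mult)
    then show ?thesis
      using \<open>0 < c\<close> wave_mass_less_one[OF assms \<alpha> wave] \<gamma> by simp
  qed
  show ?thesis
    by (rule exI[of _ 1], intro conjI allI impI exI[of _ 1]) (use main in auto)
qed

end
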